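(* Let $\alpha\in\mathbb{R}$ and $\beta\in\mathbb{C}$. Then for every integer $n\ge 0$, $$e^{-\frac{\alpha}{2}D^2-\beta D}x^n=H_n^\alpha(x-\beta).$$ Furthermore, if $\alpha>0$ and $\beta$ is real, then the linear transformation $T:\mathbb{R}[x]\to\mathbb{R}[x]$ defined by $T[x^n]=H_n^\alpha(x-\beta)$ for all $n\ge 0$ has the property that whenever $p(x)\in\mathbb{R}[x]$ is a polynomial with only real roots, $T[p(x)]$ also has only real roots.
   Context: $D$ denotes differentiation with respect to $x$. If $e^{-\frac{\alpha}{2}x^2-\beta x}=\sum_{k=0}^\infty\frac{\gamma_k}{k!}x^k$, then $e^{-\frac{\alpha}{2}D^2-\beta D}$ is the operator $f\mapsto\sum_{k=0}^\infty\frac{\gamma_k}{k!}f^{(k)}$ on polynomials. For a real parameter $\alpha$, the generalized Hermite polynomials $H_n^\alpha(x)$ are defined by $H_{-1}^\alpha(x)=0$, $H_0^\alpha(x)=1$, and $H_n^\alpha(x)=xH_{n-1}^\alpha(x)-\alpha(n-1)H_{n-2}^\alpha(x)$ for $n\ge 1$. *)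

theory Defs
  imports "HOL-Complex_Analysis.Complex_Analysis" "HOL-Computational_Algebra.Computational_Algebra"
begin

text \<open>The convention \<open>H\<^bsub>-1\<^esub> = 0\<close> only enters at \<open>n = 1\<close>, where it gives \<open>H\<^sub>1 = x H\<^sub>0\<close>.\<close>

fun gen_hermite :: "real \<Rightarrow> nat \<Rightarrow> real poly" where
  "gen_hermite \<alpha> 0 = 1"
| "gen_hermite \<alpha> (Suc 0) = [:0, 1:] * gen_hermite \<alpha> 0"
| "gen_hermite \<alpha> (Suc (Suc n)) =
     [:0, 1:] * gen_hermite \<alpha> (Suc n) - smult (\<alpha> * real (Suc n)) (gen_hermite \<alpha> n)"

definition exp_coeff :: "real \<Rightarrow> complex \<Rightarrow> nat \<Rightarrow> complex" where
  "exp_coeff \<alpha> \<beta> = (THE \<gamma>. \<forall>x::complex.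
     (\<lambda>k. \<gamma> k / fact k * x ^ k) sums exp (- (complex_of_real \<alpha> / 2) * x\<^sup>2 - \<beta> * x))"

lemma exp_coeff_ex1:
  "\<exists>!\<gamma>. \<forall>x::complex.
     (\<lambda>k. \<gamma> k / fact k * x ^ k) sums exp (- (complex_of_real \<alpha> / 2) * x\<^sup>2 - \<beta> * x)"
proof (rule ex_ex1I)
  let ?f = "\<lambda>x::complex. exp (- (complex_of_real \<alpha> / 2) * x\<^sup>2 - \<beta> * x)"
  show "\<exists>\<gamma>. \<forall>x. (\<lambda>k. \<gamma> k / fact k * x ^ k) sums ?f x"
  proof (intro exI allI)
    fix x :: complex
    have "?f holomorphic_on ball 0 (norm x + 1)"
      by (intro holomorphic_intros)
    from holomorphic_power_series[OF this, of x]
    show "(\<lambda>k. (deriv ^^ k) ?f 0 / fact k * x ^ k) sums ?f x"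
      by simp
  qed
next
  let ?f = "\<lambda>x::complex. exp (- (complex_of_real \<alpha> / 2) * x\<^sup>2 - \<beta> * x)"
  fix \<gamma> \<delta> :: "nat \<Rightarrow> complex"
  assume *: "\<forall>x. (\<lambda>k. \<gamma> k / fact k * x ^ k) sums ?f x" "\<forall>x. (\<lambda>k. \<delta> k / fact k * x ^ k) sums ?f x"
  have "?f has_fps_expansion Abs_fps (\<lambda>k. \<gamma> k / fact k)"
    using *(1) by (intro has_fps_expansionI) simp
  moreover have "?f has_fps_expansion Abs_fps (\<lambda>k. \<delta> k / fact k)"
    using *(2) by (intro has_fps_expansionI) simp
  ultimately have "Abs_fps (\<lambda>k. \<gamma> k / fact k) = Abs_fps (\<lambda>k. \<delta> k / fact k)"
    by (rule fps_expansion_unique_complex)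
  then show "\<gamma> = \<delta>"
    by (auto simp: fps_eq_iff)
qed

lemma exp_coeff_sums:
  "(\<lambda>k. exp_coeff \<alpha> \<beta> k / fact k * x ^ k) sums exp (- (complex_of_real \<alpha> / 2) * x\<^sup>2 - \<beta> * x)"
  using theI'[OF exp_coeff_ex1, of \<alpha> \<beta>] unfolding exp_coeff_def by blast

text \<open>The defining series is cut off at the degree, beyond which all derivatives vanish.\<close>

definition exp_diff_op :: "real \<Rightarrow> complex \<Rightarrow> complex poly \<Rightarrow> complex poly" where
  "exp_diff_op \<alpha> \<beta> f = (\<Sum>k\<le>degree f. smult (exp_coeff \<alpha> \<beta> k / fact k) ((pderiv ^^ k) f))"

text \<open>``Only real roots'' refers to the complex roots. The zero polynomial, of which
  every complex number is a root, does not count; nonzero constants do.\<close>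

definition only_real_roots :: "real poly \<Rightarrow> bool" where
  "only_real_roots p \<longleftrightarrow> (\<forall>z::complex. poly (map_poly complex_of_real p) z = 0 \<longrightarrow> z \<in> \<real>)"

end

theory Submission
  imports Defs
begin

text \<open>Since \<open>g x = exp (-\<alpha> x\<^sup>2/2 - \<beta> x)\<close> satisfies \<open>g' = (-\<alpha> x - \<beta>) g\<close>, the operator \<open>L = g(D)\<close>
  satisfies \<open>L (x f) = x L f + g'(D) f = (x - \<beta>) L f - \<alpha> L f'\<close>, which on powers of \<open>x\<close> is the
  recurrence of the shifted Hermite polynomials. As \<open>T\<close> commutes with \<open>D\<close>, the same identity gives
  \<open>T ((x - r) f) = (x - b - r) T f - \<alpha> (T f)'\<close>. The right-hand side preserves real-rootedness of
  \<open>h = T f\<close>: \<open>h'/h = \<Sum> 1 / (z - r\<^sub>i)\<close> maps the open upper half-plane to the closed lower one and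
  vice versa, so \<open>\<alpha> h'/h = z - b - r\<close> has no non-real solution. Inserting the roots of a polynomial
  one at a time proves the claim.\<close>

subsection \<open>Polynomials\<close>

text \<open>Meant for identities linear in \<open>f\<close>, where only the powers of x need a
  computation.\<close>

lemma poly_monom_induct [case_names monom smult add]:
  fixes f :: "'a::comm_semiring_1 poly"
  assumes "\<And>n. P (monom 1 n)" "\<And>a f. P f \<Longrightarrow> P (smult a f)" "\<And>f g. P f \<Longrightarrow> P g \<Longrightarrow> P (f + g)"
  shows "P f"
proof -
  have m: "P (monom a n)" for a n
    using assms(2)[OF assms(1)[of n], of a] by (simp add: smult_monom)
  have "P (\<Sum>i\<le>n. monom (coeff f i) i)" for n
    by (induction n) (auto intro: m assms(3))
  then show ?thesis
    by (metis poly_as_sum_of_monoms)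
qed

text \<open>Leibniz rule for x * f: as the second derivative of x is zero, only two terms
  survive.\<close>

lemma higher_pderiv_pCons_0:
  "(pderiv ^^ Suc k) (pCons 0 f) = pCons 0 ((pderiv ^^ Suc k) f) + smult (of_nat (Suc k)) ((pderiv ^^ k) f)"
proof (induction k)
  case 0
  show ?case by (simp add: pderiv_pCons add.commute)
next
  case (Suc k)
  have "(pderiv ^^ Suc (Suc k)) (pCons 0 f) = pderiv ((pderiv ^^ Suc k) (pCons 0 f))"
    by simp
  also have "\<dots> = pderiv (pCons 0 ((pderiv ^^ Suc k) f) + smult (of_nat (Suc k)) ((pderiv ^^ k) f))"
    by (simp only: Suc.IH)
  also have "\<dots> = pCons 0 ((pderiv ^^ Suc (Suc k)) f)
      + smult (of_nat (Suc (Suc k))) ((pderiv ^^ Suc k) f)"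
    by (simp add: pderiv_add pderiv_pCons pderiv_smult smult_add_left add_ac)
  finally show ?case .
qed

lemma higher_pderiv_eq_0:
  fixes f :: "'a::{comm_semiring_1,semiring_no_zero_divisors,semiring_char_0} poly"
  assumes "degree f < k"
  shows "(pderiv ^^ k) f = 0"
  using assms
proof (induction k arbitrary: f)
  case (Suc k)
  show ?case
  proof (cases "degree f = 0")
    case True
    then have "pderiv f = 0" by (simp add: pderiv_eq_0_iff)
    then show ?thesis by (simp add: funpow_Suc_right del: funpow.simps)
  next
    case False
    then have "(pderiv ^^ k) (pderiv f) = 0"
      using Suc.prems by (intro Suc.IH) (simp add: degree_pderiv)
    then show ?thesis by (simp add: funpow_Suc_right del: funpow.simps)
  qed
qed simp

lemma smult_sum_right: "smult c (sum f A) = (\<Sum>x\<in>A. smult c (f x))"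
  by (induction A rule: infinite_finite_induct) (simp_all add: smult_add_right)

lemma
  fixes p q :: "real poly"
  shows degree_of_real_poly [simp]: "degree (map_poly of_real p :: 'a::{real_algebra_1,field} poly) = degree p"
    and of_real_poly_smult [simp]: "map_poly of_real (smult c p) = smult (of_real c :: 'a) (map_poly of_real p)"
    and of_real_poly_diff [simp]: "map_poly of_real (p - q) = (map_poly of_real p - map_poly of_real q :: 'a poly)"
    and of_real_poly_mult: "map_poly of_real (p * q) = (map_poly of_real p * map_poly of_real q :: 'a poly)"
    and of_real_poly_pderiv [simp]: "map_poly of_real (pderiv p) = pderiv (map_poly of_real p :: 'a poly)"
    and poly_of_real_poly [simp]: "poly (map_poly of_real p) (of_real x :: 'a) = of_real (poly p x)"
proof -
  show "degree (map_poly of_real p :: 'a poly) = degree p"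
    by (rule degree_map_poly) simp
  show "poly (map_poly of_real p) (of_real x :: 'a) = of_real (poly p x)"
    by (induction p) (simp_all add: map_poly_pCons)
qed (rule poly_eqI; simp add: coeff_map_poly coeff_mult coeff_pderiv)+

subsection \<open>The exponential operator\<close>

text \<open>The Taylor series F of g(x) = exp (-\<alpha> x^2/2 - \<beta> x) can be differentiated
  termwise or through g' = (-\<alpha> x - \<beta>) g. Uniqueness of power series equates the two
  results, and comparing coefficients gives the recurrence.\<close>

lemma exp_coeff_rec:
  shows "exp_coeff \<alpha> \<beta> 0 = 1"
    and "exp_coeff \<alpha> \<beta> 1 = - \<beta>"
    and "exp_coeff \<alpha> \<beta> (Suc (Suc k))
      = - \<beta> * exp_coeff \<alpha> \<beta> (Suc k) - complex_of_real \<alpha> * of_nat (Suc k) * exp_coeff \<alpha> \<beta> k"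
proof -
  let ?f = "\<lambda>x::complex. exp (- (complex_of_real \<alpha> / 2) * x\<^sup>2 - \<beta> * x)"
  define F where "F = Abs_fps (\<lambda>k. exp_coeff \<alpha> \<beta> k / fact k)"
  have F: "?f has_fps_expansion F"
    unfolding F_def using exp_coeff_sums by (intro has_fps_expansionI) simp
  then have "deriv ?f has_fps_expansion fps_deriv F"
    by (rule has_fps_expansion_deriv)
  moreover have "deriv ?f = (\<lambda>x. (- complex_of_real \<alpha> * x - \<beta>) * ?f x)"
    by (rule ext, rule DERIV_imp_deriv) (auto intro!: derivative_eq_intros)
  ultimately have "(\<lambda>x. (- complex_of_real \<alpha> * x - \<beta>) * ?f x) has_fps_expansion fps_deriv F"
    by simp
  moreover have "(\<lambda>x. (- complex_of_real \<alpha> * x - \<beta>) * ?f x) has_fps_expansion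
      (fps_const (- complex_of_real \<alpha>) * fps_X - fps_const \<beta>) * F"
    by (intro fps_expansion_intros F)
  ultimately have eq: "fps_deriv F = (fps_const (- complex_of_real \<alpha>) * fps_X - fps_const \<beta>) * F"
    by (rule fps_expansion_unique_complex)
  show 0: "exp_coeff \<alpha> \<beta> 0 = 1"
    using has_fps_expansion_imp_0_eq_fps_nth_0[OF F] by (simp add: F_def)
  \<comment> \<open>Coefficient of x^n in \<open>eq\<close>; the product with \<open>fps_X\<close>
    has no constant term, hence the case \<open>n = 0\<close>.\<close>
  have *: "of_nat (Suc n) * fps_nth F (Suc n)
      = - complex_of_real \<alpha> * (if n = 0 then 0 else fps_nth F (n - 1)) - \<beta> * fps_nth F n" for n
    using arg_cong[OF eq, of "\<lambda>G. fps_nth G n"]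
    by (simp add: left_diff_distrib mult.assoc)
  show "exp_coeff \<alpha> \<beta> 1 = - \<beta>"
    using *[of 0] 0 by (simp add: F_def)
  have "of_nat (Suc (Suc k)) * (exp_coeff \<alpha> \<beta> (Suc (Suc k)) / fact (Suc (Suc k)))
      = - complex_of_real \<alpha> * (exp_coeff \<alpha> \<beta> k / fact k)
        - \<beta> * (exp_coeff \<alpha> \<beta> (Suc k) / fact (Suc k))"
    using *[of "Suc k"] by (simp add: F_def)
  moreover have "of_nat (Suc (Suc k)) * (exp_coeff \<alpha> \<beta> (Suc (Suc k)) / fact (Suc (Suc k)))
      = exp_coeff \<alpha> \<beta> (Suc (Suc k)) / fact (Suc k)"
    unfolding fact_Suc[of "Suc k"] by (simp del: of_nat_Suc fact_Suc)
  ultimately have "exp_coeff \<alpha> \<beta> (Suc (Suc k)) = fact (Suc k) *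
      (- complex_of_real \<alpha> * (exp_coeff \<alpha> \<beta> k / fact k)
        - \<beta> * (exp_coeff \<alpha> \<beta> (Suc k) / fact (Suc k)))"
    by (simp add: divide_eq_eq mult.commute del: of_nat_Suc fact_Suc)
  also have "\<dots> = - \<beta> * exp_coeff \<alpha> \<beta> (Suc k)
      - complex_of_real \<alpha> * of_nat (Suc k) * exp_coeff \<alpha> \<beta> k"
    unfolding right_diff_distrib by (simp add: field_simps del: of_nat_Suc)
  finally show "exp_coeff \<alpha> \<beta> (Suc (Suc k))
      = - \<beta> * exp_coeff \<alpha> \<beta> (Suc k) - complex_of_real \<alpha> * of_nat (Suc k) * exp_coeff \<alpha> \<beta> k" .
qed

text \<open>Derivatives beyond the degree vanish. Raising the cut-off lets polynomials of different
  degrees share one summation range.\<close>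

lemma exp_diff_op_eq_sum:
  assumes "degree f \<le> N"
  shows "exp_diff_op \<alpha> \<beta> f = (\<Sum>k\<le>N. smult (exp_coeff \<alpha> \<beta> k / fact k) ((pderiv ^^ k) f))"
  unfolding exp_diff_op_def
  using assms by (intro sum.mono_neutral_left) (auto simp: higher_pderiv_eq_0)

lemma exp_diff_op_smult: "exp_diff_op \<alpha> \<beta> (smult a f) = smult a (exp_diff_op \<alpha> \<beta> f)"
proof -
  have "smult a (exp_diff_op \<alpha> \<beta> f)
      = (\<Sum>k\<le>degree f. smult a (smult (exp_coeff \<alpha> \<beta> k / fact k) ((pderiv ^^ k) f)))"
    unfolding exp_diff_op_def by (rule smult_sum_right)
  then show ?thesis
    by (simp add: exp_diff_op_eq_sum[of "smult a f" "degree f"] higher_pderiv_smult mult.commute)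
qed

text \<open>The commutation rule g(D) x = x g(D) + g'(D), with g'(D) = -\<alpha> D g(D) - \<beta>
  g(D), carried out on coefficients.\<close>

lemma exp_diff_op_pCons_0:
  "exp_diff_op \<alpha> \<beta> (pCons 0 f) =
    [:- \<beta>, 1:] * exp_diff_op \<alpha> \<beta> f - smult (complex_of_real \<alpha>) (exp_diff_op \<alpha> \<beta> (pderiv f))"
proof -
  define c where "c k = exp_coeff \<alpha> \<beta> k / fact k" for k
  define N where "N = degree f"
  define d where "d k = (pderiv ^^ k) f" for k
  have c0: "c 0 = 1" and c1: "c (Suc 0) = - \<beta>"
    using exp_coeff_rec(1,2)[of \<alpha> \<beta>] by (simp_all add: c_def)
  \<comment> \<open>With \<open>c\<close> the Taylor coefficients of g, this compares the
    coefficients of x^(k+1) in g' = (-\<alpha> x - \<beta>) g.\<close>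
  have c2: "c (Suc (Suc k)) * of_nat (Suc (Suc k)) = - \<beta> * c (Suc k) - complex_of_real \<alpha> * c k" for k
  proof -
    have "c (Suc (Suc k)) * of_nat (Suc (Suc k)) = exp_coeff \<alpha> \<beta> (Suc (Suc k)) / fact (Suc k)"
      unfolding c_def fact_Suc[of "Suc k"] by (simp del: of_nat_Suc fact_Suc)
    also have "\<dots> = - \<beta> * c (Suc k) - complex_of_real \<alpha> * c k"
      unfolding c_def exp_coeff_rec(3) by (simp add: field_simps del: of_nat_Suc)
    finally show ?thesis .
  qed
  have dd: "(pderiv ^^ k) (pderiv f) = d (Suc k)" for k
    by (simp add: d_def funpow_Suc_right del: funpow.simps)
  \<comment> \<open>The degree is at most \<open>Suc N\<close>; the extra index leaves room for two
    shifts, even if \<open>N = 0\<close>.\<close>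
  have "exp_diff_op \<alpha> \<beta> (pCons 0 f)
      = (\<Sum>k\<le>Suc (Suc N). smult (c k) ((pderiv ^^ k) (pCons 0 f)))"
    unfolding c_def N_def by (rule exp_diff_op_eq_sum) (simp add: degree_pCons_eq_if)
  also have "\<dots> = pCons 0 f
      + (\<Sum>k\<le>Suc N. smult (c (Suc k)) (pCons 0 (d (Suc k)) + smult (of_nat (Suc k)) (d k)))"
    by (simp only: sum.atMost_Suc_shift c0 higher_pderiv_pCons_0 d_def) simp
  \<comment> \<open>The bracket is x g(D) f, with \<open>pCons 0 f\<close> as its term for index 0;
    the last sum is g'(D) f.\<close>
  also have "\<dots> = (pCons 0 f + (\<Sum>k\<le>Suc N. [:0, 1:] * smult (c (Suc k)) (d (Suc k))))
      + (\<Sum>k\<le>Suc N. smult (c (Suc k) * of_nat (Suc k)) (d k))"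
    by (simp add: smult_add_right sum.distrib del: sum.atMost_Suc of_nat_Suc)
  also have "pCons 0 f + (\<Sum>k\<le>Suc N. [:0, 1:] * smult (c (Suc k)) (d (Suc k)))
      = [:0, 1:] * (\<Sum>k\<le>Suc (Suc N). smult (c k) (d k))"
    by (simp only: sum.atMost_Suc_shift[of _ "Suc N"] c0 distrib_left sum_distrib_left)
      (simp add: d_def)
  also have "(\<Sum>k\<le>Suc (Suc N). smult (c k) (d k)) = exp_diff_op \<alpha> \<beta> f"
    unfolding c_def d_def by (rule exp_diff_op_eq_sum[symmetric]) (simp add: N_def)
  also have "(\<Sum>k\<le>Suc N. smult (c (Suc k) * of_nat (Suc k)) (d k))
      = smult (- \<beta>) f + (\<Sum>k\<le>N. smult (- \<beta>) (smult (c (Suc k)) (d (Suc k)))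
          - smult (complex_of_real \<alpha>) (smult (c k) (d (Suc k))))"
    by (simp only: sum.atMost_Suc_shift c2) (simp add: c1 d_def smult_diff_left)
  also have "\<dots> = smult (- \<beta>) (\<Sum>k\<le>Suc N. smult (c k) (d k))
      - smult (complex_of_real \<alpha>) (\<Sum>k\<le>N. smult (c k) (d (Suc k)))"
    by (simp only: sum.atMost_Suc_shift[of _ N] c0 smult_add_right smult_sum_right sum_subtractf)
      (simp add: d_def)
  also have "(\<Sum>k\<le>Suc N. smult (c k) (d k)) = exp_diff_op \<alpha> \<beta> f"
    unfolding c_def d_def by (rule exp_diff_op_eq_sum[symmetric]) (simp add: N_def)
  also have "(\<Sum>k\<le>N. smult (c k) (d (Suc k))) = exp_diff_op \<alpha> \<beta> (pderiv f)"
    unfolding c_def dd[symmetric]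
    by (rule exp_diff_op_eq_sum[symmetric]) (simp add: N_def degree_pderiv)
  finally show ?thesis
    by simp
qed

text \<open>As D x^(n+1) = (n+1) x^n, the rule for \<open>pCons 0\<close> applied to x^(n+1) is the
  Hermite recurrence at x - \<beta>.\<close>

lemma exp_diff_op_monom:
  "exp_diff_op \<alpha> \<beta> (monom 1 n)
     = pcompose (map_poly complex_of_real (gen_hermite \<alpha> n)) [:- \<beta>, 1:]"
proof -
  have one: "exp_diff_op \<alpha> \<beta> 1 = 1"
    using exp_coeff_rec(1)[of \<alpha> \<beta>] by (simp add: exp_diff_op_def)
  have z: "exp_diff_op \<alpha> \<beta> 0 = 0"
    by (simp add: exp_diff_op_def)
  show ?thesis
  proof (induction n rule: induct_nat_012)
    case 0
    show ?case by (simp add: one monom_0 pcompose_1 flip: one_pCons)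
  next
    case 1
    have "exp_diff_op \<alpha> \<beta> (monom 1 (Suc 0)) = [:- \<beta>, 1:]"
      using exp_diff_op_pCons_0[of \<alpha> \<beta> 1] by (simp add: monom_Suc one z monom_0 flip: one_pCons)
    then show ?case
      by (simp add: map_poly_pCons pcompose_pCons)
  next
    case (ge2 n)
    have "exp_diff_op \<alpha> \<beta> (monom 1 (Suc (Suc n)))
        = [:- \<beta>, 1:] * exp_diff_op \<alpha> \<beta> (monom 1 (Suc n))
          - smult (complex_of_real \<alpha> * of_nat (Suc n)) (exp_diff_op \<alpha> \<beta> (monom 1 n))"
    proof -
      have "pderiv (monom 1 (Suc n)) = smult (of_nat (Suc n)) (monom (1::complex) n)"
        by (simp add: pderiv_monom smult_monom)
      then show ?thesis
        unfolding monom_Suc[of _ "Suc n"] exp_diff_op_pCons_0 by (simp only: exp_diff_op_smult smult_smult)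
    qed
    also have "\<dots> = pcompose (map_poly complex_of_real (gen_hermite \<alpha> (Suc (Suc n)))) [:- \<beta>, 1:]"
      unfolding ge2
      by (simp add: map_poly_pCons pcompose_diff pcompose_smult pcompose_pCons del: of_nat_Suc)
    finally show ?case .
  qed
qed

subsection \<open>Real-rootedness\<close>

text \<open>The Appell property, which expresses that \<open>T\<close> commutes with D.
  Differentiating the recurrence leaves one undifferentiated term plus a multiple of the recurrence
  one index lower.\<close>

lemma pderiv_gen_hermite: "pderiv (gen_hermite \<alpha> (Suc n)) = smult (real (Suc n)) (gen_hermite \<alpha> n)"
proof (induction n rule: induct_nat_012)
  case 0
  then show ?case by (simp add: pderiv_pCons)
next
  case 1
  then show ?case by (simp add: pderiv_pCons pderiv_diff one_pCons)
next
  case (ge2 n)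
  have "pderiv (gen_hermite \<alpha> (Suc (Suc (Suc n))))
      = gen_hermite \<alpha> (Suc (Suc n)) + [:0, 1:] * pderiv (gen_hermite \<alpha> (Suc (Suc n)))
        - smult (\<alpha> * real (Suc (Suc n))) (pderiv (gen_hermite \<alpha> (Suc n)))"
    by (simp only: gen_hermite.simps(3)[of \<alpha> "Suc n"] pderiv_diff pderiv_mult pderiv_smult)
      (simp add: pderiv_pCons)
  also have "\<dots> = gen_hermite \<alpha> (Suc (Suc n)) + smult (real (Suc (Suc n)))
      ([:0, 1:] * gen_hermite \<alpha> (Suc n) - smult (\<alpha> * real (Suc n)) (gen_hermite \<alpha> n))"
    unfolding ge2 by (simp add: smult_diff_right mult_ac del: gen_hermite.simps of_nat_Suc)
  also have "\<dots> = smult (real (Suc (Suc (Suc n)))) (gen_hermite \<alpha> (Suc (Suc n)))"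
    by (simp only: gen_hermite.simps(3)[symmetric] of_nat_Suc[of "Suc (Suc n)"]
        smult_add_left smult_1_left)
  finally show ?case .
qed

lemma only_real_roots_mult:
  "only_real_roots (p * q) \<longleftrightarrow> only_real_roots p \<and> only_real_roots q"
  by (auto simp: only_real_roots_def of_real_poly_mult)

text \<open>The fundamental theorem of algebra supplies a root, which is real by assumption, so a
  real linear factor splits off and the degree drops.\<close>

lemma only_real_roots_induct [consumes 1, case_names const linear]:
  assumes "only_real_roots p"
    and const: "\<And>c. c \<noteq> 0 \<Longrightarrow> P [:c:]"
    and linear: "\<And>r q. only_real_roots q \<Longrightarrow> P q \<Longrightarrow> P ([:- r, 1:] * q)"
  shows "P p"
  using assms(1)
proof (induction "degree p" arbitrary: p)
  case 0
  then obtain c where c: "p = [:c:]"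
    by (metis degree_eq_zeroE)
  \<comment> \<open>A non-real root of the zero polynomial, which excludes
    \<open>c = 0\<close>.\<close>
  have "\<i> \<notin> \<real>"
    by (simp add: complex_is_Real_iff)
  then have "c \<noteq> 0"
    using 0 c unfolding only_real_roots_def by (metis map_poly_0 pCons_0_0 poly_0)
  then show ?case
    using c const by simp
next
  case (Suc n)
  have "degree (map_poly complex_of_real p) \<noteq> 0"
    using Suc(2) by simp
  then obtain z where z: "poly (map_poly complex_of_real p) z = 0"
    using fundamental_theorem_of_algebra[of "map_poly complex_of_real p"]
    by (metis constant_degree)
  then obtain r where "z = complex_of_real r"
    using Suc.prems by (auto simp: only_real_roots_def elim: Reals_cases)
  then have "poly p r = 0"
    using z by simp
  then obtain q where q: "p = [:- r, 1:] * q"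
    by (metis poly_eq_0_iff_dvd dvdE)
  have "q \<noteq> 0"
    using q Suc(2) by auto
  then have "degree p = Suc (degree q)"
    unfolding q by (subst degree_mult_eq) auto
  then show ?case
    using Suc q linear only_real_roots_mult by (metis Suc_inject)
qed

text \<open>Each linear factor adds 1/(z - r) to P'/P, with imaginary part -Im z / |z - r|^2. The
  factor \<open>Im z\<close> treats both half-planes at once and makes real z, possibly a root,
  trivial.\<close>

lemma Im_logderiv_real_rooted:
  assumes "only_real_roots p"
  defines "P \<equiv> map_poly complex_of_real p"
  shows "Im z * Im (poly (pderiv P) z / poly P z) \<le> 0"
  using assms(1) unfolding P_def
proof (induction rule: only_real_roots_induct)
  case (const c)
  then show ?case by (simp add: map_poly_pCons)
next
  case (linear r q)
  let ?Q = "map_poly complex_of_real q"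
  show ?case
  proof (cases "Im z = 0")
    case False
    then have nz: "z - complex_of_real r \<noteq> 0" "poly ?Q z \<noteq> 0"
      using linear(1) by (auto simp: only_real_roots_def complex_is_Real_iff complex_eq_iff)
    have eq: "map_poly complex_of_real ([:- r, 1:] * q) = [:- complex_of_real r, 1:] * ?Q"
      by (simp only: of_real_poly_mult) (simp add: map_poly_pCons)
    have "poly (pderiv ([:- complex_of_real r, 1:] * ?Q)) z / poly ([:- complex_of_real r, 1:] * ?Q) z
        = 1 / (z - complex_of_real r) + poly (pderiv ?Q) z / poly ?Q z"
      using nz by (simp only: pderiv_mult) (simp add: pderiv_pCons divide_simps, simp add: algebra_simps)
    moreover have "Im z * Im (1 / (z - complex_of_real r)) \<le> 0"
      by (simp add: Im_divide divide_nonneg_nonneg)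
    ultimately show ?thesis
      using linear(2) unfolding eq by (simp add: distrib_left)
  qed simp
qed

text \<open>At a non-real root z, p does not vanish, so z - c = \<alpha> p'(z)/p(z), whose two sides
  have imaginary parts of conflicting sign. This also shows that the new polynomial is nonzero,
  since the zero polynomial has non-real roots.\<close>

lemma only_real_roots_mult_X_minus_pderiv:
  assumes p: "only_real_roots p" and "\<alpha> \<ge> 0"
  shows "only_real_roots ([:- c, 1:] * p - smult \<alpha> (pderiv p))"
  unfolding only_real_roots_def
proof (intro allI impI, rule ccontr)
  fix z :: complex
  let ?P = "map_poly complex_of_real p"
  assume z: "poly (map_poly complex_of_real ([:- c, 1:] * p - smult \<alpha> (pderiv p))) z = 0"
    and "z \<notin> \<real>"
  then have im: "Im z \<noteq> 0" and nz: "poly ?P z \<noteq> 0"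
    using p by (auto simp: only_real_roots_def complex_is_Real_iff)
  have "map_poly complex_of_real ([:- c, 1:] * p - smult \<alpha> (pderiv p))
      = [:- complex_of_real c, 1:] * ?P - smult (complex_of_real \<alpha>) (pderiv ?P)"
    by (simp only: of_real_poly_diff of_real_poly_mult of_real_poly_smult of_real_poly_pderiv) (simp add: map_poly_pCons)
  then have "(z - complex_of_real c) * poly ?P z = complex_of_real \<alpha> * poly (pderiv ?P) z"
    using z by (simp add: left_diff_distrib)
  then have "z - complex_of_real c = complex_of_real \<alpha> * (poly (pderiv ?P) z / poly ?P z)"
    using nz by (simp add: field_simps)
  then have "Im (z - complex_of_real c) = Im (complex_of_real \<alpha> * (poly (pderiv ?P) z / poly ?P z))"
    by (rule arg_cong)
  then have "Im z = \<alpha> * Im (poly (pderiv ?P) z / poly ?P z)"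
    unfolding Im_complex_of_real minus_complex.sel times_complex.sel Re_complex_of_real by simp
  then have "(Im z)\<^sup>2 = \<alpha> * (Im z * Im (poly (pderiv ?P) z / poly ?P z))"
    by (simp add: power2_eq_square)
  also have "\<dots> \<le> 0"
    using Im_logderiv_real_rooted[OF p] \<open>\<alpha> \<ge> 0\<close> by (simp add: mult_nonneg_nonpos)
  finally show False
    using im by simp
qed

text \<open>On x^n, the Appell property turns the term \<alpha> n H_(n-1) of the recurrence into
  \<alpha> times the derivative of H_n. The result involves \<open>T f\<close> alone, as an
  induction over linear factors requires.\<close>

lemma hermite_transform_pCons_0:
  fixes T :: "real poly \<Rightarrow> real poly"
  assumes T: "Vector_Spaces.linear smult smult T"
    and mon: "\<And>n. T (monom 1 n) = pcompose (gen_hermite \<alpha> n) [:- b, 1:]"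
  shows "T (pCons 0 f) = [:- b, 1:] * T f - smult \<alpha> (pderiv (T f))"
proof -
  have add: "T (f + g) = T f + T g" and scale: "T (smult a f) = smult a (T f)" for a f g
    using T by (simp_all add: Vector_Spaces.linear_iff)
  show ?thesis
  proof (induction f rule: poly_monom_induct)
    case (monom n)
    show ?case
    proof (cases n)
      case 0
      then show ?thesis
        unfolding monom_Suc[symmetric] mon by (simp add: pcompose_pCons pcompose_1)
    next
      case (Suc m)
      have "pderiv (pcompose (gen_hermite \<alpha> (Suc m)) [:- b, 1:])
          = smult (real (Suc m)) (pcompose (gen_hermite \<alpha> m) [:- b, 1:])"
        by (simp add: pderiv_pcompose pderiv_gen_hermite pcompose_smult pderiv_pCons
            del: gen_hermite.simps of_nat_Suc)
      then show ?thesis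
        unfolding monom_Suc[symmetric] mon Suc
        by (simp add: pcompose_diff pcompose_mult pcompose_smult pcompose_pCons del: of_nat_Suc)
    qed
  next
    case (smult a f)
    have "pCons 0 (smult a f) = smult a (pCons 0 f)" by simp
    then show ?case
      by (simp only: scale smult pderiv_smult) (simp add: smult_diff_right smult_smult mult.commute)
  next
    case (add f g)
    have "pCons 0 (f + g) = pCons 0 f + pCons 0 g" by simp
    then show ?case
      by (simp only: \<open>\<And>f g. T (f + g) = T f + T g\<close> add pderiv_add)
        (simp add: smult_add_right algebra_simps)
  qed
qed

lemma hermite_transform_only_real_roots:
  fixes T :: "real poly \<Rightarrow> real poly"
  assumes T: "Vector_Spaces.linear smult smult T"
    and mon: "\<And>n. T (monom 1 n) = pcompose (gen_hermite \<alpha> n) [:- b, 1:]"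
    and "\<alpha> \<ge> 0" "only_real_roots p"
  shows "only_real_roots (T p)"
  using assms(4)
proof (induction rule: only_real_roots_induct)
  case (const c)
  have "T [:c:] = smult c (T (monom 1 0))"
    using T unfolding Vector_Spaces.linear_iff by (metis smult_monom mult_1_right monom_0)
  then have "T [:c:] = [:c:]"
    unfolding mon by (simp add: pcompose_1)
  then show ?case
    using const by (simp add: only_real_roots_def map_poly_pCons)
next
  case (linear r q)
  have "[:- r, 1:] * q = pCons 0 q + smult (- r) q"
    by simp
  then have "T ([:- r, 1:] * q) = T (pCons 0 q) + smult (- r) (T q)"
    using T by (simp only: Vector_Spaces.linear_iff)
  \<comment> \<open>The root \<open>r\<close> only moves the shift from \<open>b\<close> to
    \<open>b + r\<close>, so the previous real-rootedness result applies to
    \<open>T q\<close>.\<close>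
  also have "\<dots> = [:- (b + r), 1:] * T q - smult \<alpha> (pderiv (T q))"
    by (simp add: hermite_transform_pCons_0[OF T mon] smult_diff_left smult_add_left algebra_simps)
  finally show ?case
    by (simp only: only_real_roots_mult_X_minus_pderiv[OF linear(2) \<open>\<alpha> \<ge> 0\<close>])
qed

theorem lemma2p7:
  fixes \<alpha> :: real and \<beta> :: complex
  shows "(\<forall>n::nat. exp_diff_op \<alpha> \<beta> (monom 1 n)
            = pcompose (map_poly complex_of_real (gen_hermite \<alpha> n)) [:- \<beta>, 1:])
       \<and> (\<forall>b::real. \<alpha> > 0 \<and> \<beta> = complex_of_real b \<longrightarrow>
            (\<forall>T :: real poly \<Rightarrow> real poly.
               Vector_Spaces.linear smult smult T \<and>
               (\<forall>n::nat. T (monom 1 n) = pcompose (gen_hermite \<alpha> n) [:- b, 1:]) \<longrightarrow>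
               (\<forall>p. only_real_roots p \<longrightarrow> only_real_roots (T p))))"
  using exp_diff_op_monom hermite_transform_only_real_roots by (metis less_eq_real_def)

end
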